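(* Let $L \subseteq \mathbb{R}^n$ be an $n$-dimensional lattice, and for $\alpha>0$ let $f_\alpha(r) = e^{-\alpha r}$ and $p(f_\alpha, L, z) = \sum_{x \in L} e^{-\alpha\|x-z\|^2}$. For a point $z \in \mathbb{R}^n$ the following statements are equivalent: (1) Every non-empty inhomogeneous shell $L(z,r) = \{x \in L : \|x-z\| = r\}$, with $r \geq 0$, forms a spherical $1$-design. (2) $z$ is a critical point of the function $w \mapsto p(f_\alpha, L, w)$ on $\mathbb{R}^n$ for all $\alpha > 0$. (3) There exists an $\alpha_0>0$ such that $z$ is a critical point of $w \mapsto p(f_\alpha, L, w)$ for every $\alpha \geq \alpha_0$.
   Context: An $n$-dimensional lattice in $\mathbb{R}^n$ is a discrete subgroup of rank $n$. A point is critical for a differentiable function if the gradient vanishes there. A finite non-empty set $X$ on the sphere $S^{n-1}(z,r) = \{x \in \mathbb{R}^n : \|x-z\| = r\}$ is a spherical $M$-design if for every polynomial $q$ on $\mathbb{R}^n$ of total degree at most $M$ one has $\int_{S^{n-1}(0,r)} q(y)\, d\omega(y) = \frac{1}{|X|}\sum_{x \in X} q(x-z)$, where $\omega$ is the rotationally invariant probability measure on $S^{n-1}(0,r)$. In particular, $X$ is a spherical $1$-design if and only if $\sum_{x \in X}(x-z) = 0$. *)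

theory Defs
  imports "HOL-Analysis.Analysis" "HOL-Probability.Probability_Measure"
begin

section \<open>Lattices\<close>

definition int_independent :: "'a::real_vector set \<Rightarrow> bool" where
  "int_independent B \<longleftrightarrow>
     (\<forall>c :: 'a \<Rightarrow> int. (\<Sum>b\<in>B. of_int (c b) *\<^sub>R b) = 0 \<longrightarrow> (\<forall>b\<in>B. c b = 0))"

text \<open>
  Rank of an abelian group: the maximal number of elements that are linearly independent over
  the integers.  (For a discrete subgroup this is also the dimension of its real span.)
\<close>

definition has_rank :: "'a::real_vector set \<Rightarrow> nat \<Rightarrow> bool" where
  "has_rank L k \<longleftrightarrow>
     (\<exists>B\<subseteq>L. finite B \<and> card B = k \<and> int_independent B) \<and>
     (\<forall>B\<subseteq>L. finite B \<and> int_independent B \<longrightarrow> card B \<le> k)"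

definition full_lattice :: "(real^'n::finite) set \<Rightarrow> bool" where
  "full_lattice L \<longleftrightarrow>
     0 \<in> L \<and> (\<forall>x\<in>L. \<forall>y\<in>L. x - y \<in> L) \<and> discrete L \<and> has_rank L CARD('n)"

definition shell :: "'a::real_normed_vector set \<Rightarrow> 'a \<Rightarrow> real \<Rightarrow> 'a set" where
  "shell L z r = {x \<in> L. norm (x - z) = r}"


section \<open>Spherical designs\<close>

definition polys_of_degree_le :: "nat \<Rightarrow> (real^'n::finite \<Rightarrow> real) set" where
  "polys_of_degree_le M =
     {q. \<exists>(A :: ('n \<Rightarrow> nat) set) (c :: ('n \<Rightarrow> nat) \<Rightarrow> real).
           finite A \<and> (\<forall>a\<in>A. (\<Sum>i\<in>UNIV. a i) \<le> M) \<and>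
           q = (\<lambda>x. \<Sum>a\<in>A. c a * (\<Prod>i\<in>UNIV. (x $ i) ^ a i))}"

text \<open>
  Invariance is required under the full orthogonal group.  For dimension at least 2 this agrees
  with invariance under proper rotations; in dimension 1 the proper rotation group is trivial,
  and only the full group makes the measure unique.  The case \<open>r = 0\<close> is allowed: the sphere is
  then \<open>{0}\<close> and the measure is the point mass.
\<close>

definition rotation_invariant_prob_on_sphere :: "real \<Rightarrow> (real^'n::finite) measure \<Rightarrow> bool" where
  "rotation_invariant_prob_on_sphere r \<omega> \<longleftrightarrow>
     sets \<omega> = sets (restrict_space borel (sphere 0 r)) \<and> prob_space \<omega> \<and>
     (\<forall>g. orthogonal_transformation g \<longrightarrow> distr \<omega> \<omega> g = \<omega>)"

text \<open>
  The invariant probability measure on a sphere of radius \<open>r \<ge> 0\<close> exists and is unique, so the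
  existential quantifier over \<open>\<omega>\<close> below just names it.
\<close>

definition spherical_design :: "nat \<Rightarrow> real^'n::finite \<Rightarrow> real \<Rightarrow> (real^'n) set \<Rightarrow> bool" where
  "spherical_design M z r X \<longleftrightarrow>
     finite X \<and> X \<noteq> {} \<and> X \<subseteq> {x. norm (x - z) = r} \<and>
     (\<exists>\<omega>. rotation_invariant_prob_on_sphere r \<omega> \<and>
        (\<forall>q \<in> polys_of_degree_le M.
           (\<integral>y. q y \<partial>\<omega>) = (1 / real (card X)) * (\<Sum>x\<in>X. q (x - z))))"


section \<open>Potential energy and critical points\<close>

definition f_exp :: "real \<Rightarrow> real \<Rightarrow> real" where
  "f_exp \<alpha> r = exp (- \<alpha> * r)"

definition potential :: "(real \<Rightarrow> real) \<Rightarrow> 'a::real_normed_vector set \<Rightarrow> 'a \<Rightarrow> real" where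
  "potential f L z = (\<Sum>\<^sub>\<infinity>x\<in>L. f ((norm (x - z))\<^sup>2))"

definition critical_point :: "('a::real_inner \<Rightarrow> real) \<Rightarrow> 'a \<Rightarrow> bool" where
  "critical_point F z \<longleftrightarrow> (GDERIV F z :> 0)"

end

theory Submission
  imports Defs
begin

text \<open>
  The potential has gradient \<open>2\<alpha> (\<Sum>x\<in>L. exp(-\<alpha>|x-z|\<^sup>2) (x-z))\<close> at \<open>z\<close>.
  Grouping by shells, this is a generalised Dirichlet series in \<open>\<alpha>\<close> with exponents \<open>r\<^sup>2\<close>, whose
  coefficients are the shell sums of \<open>x - z\<close>.  A shell is a 1-design iff its coefficient
  vanishes; and if the series vanishes for all large \<open>\<alpha>\<close>, letting \<open>\<alpha> \<rightarrow> \<infinity>\<close> kills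
  the coefficients one after the other, starting from the smallest radius.
\<close>

section \<open>Rotation invariant measures on spheres\<close>

text \<open>Being a 1-design asserts that an invariant measure on the sphere exists, so passing from
  a zero shell sum to a design requires constructing one. Orthogonal invariance of Lebesgue measure,
  on which the construction rests, comes from a uniqueness argument, with the unit ball fixing the
  constant. On the analytic side no infinite sum is regrouped: balanced shells are exploited on
  finite balls only, and the gradient comes from summing a quadratic remainder estimate. The limit
  is made quantitative by a gap \<delta> above the smallest unbalanced radius m: relative to that
  shell, the terms further out carry an extra factor
  \<open>exp (- \<alpha> * \<delta>\<^sup>2)\<close>, up to a constant.\<close>

lemma borel_measurable_linear:
  fixes g :: "'a::euclidean_space \<Rightarrow> 'b::real_normed_vector"
  assumes "linear g"
  shows "g \<in> borel_measurable borel"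
  using assms by (intro borel_measurable_continuous_onI linear_continuous_on)
    (simp add: linear_conv_bounded_linear)

section \<open>Invariance of Lebesgue measure under orthogonal maps\<close>

lemma nn_integral_lborel_translate:
  fixes t :: "'a::euclidean_space" and f :: "'a \<Rightarrow> ennreal"
  assumes [measurable]: "f \<in> borel_measurable borel"
  shows "(\<integral>\<^sup>+x. f (t + x) \<partial>lborel) = (\<integral>\<^sup>+x. f x \<partial>lborel)"
proof -
  have "(\<integral>\<^sup>+x. f x \<partial>lborel) = (\<integral>\<^sup>+x. f x \<partial>distr lborel borel ((+) t))"
    by (simp add: lborel_distr_plus)
  also have "\<dots> = (\<integral>\<^sup>+x. f (t + x) \<partial>lborel)"
    by (subst nn_integral_distr) auto
  finally show ?thesis by simp
qed

lemma nn_integral_lborel_reflect: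
  fixes t :: "'a::euclidean_space" and f :: "'a \<Rightarrow> ennreal"
  assumes [measurable]: "f \<in> borel_measurable borel"
  shows "(\<integral>\<^sup>+x. f (t - x) \<partial>lborel) = (\<integral>\<^sup>+x. f x \<partial>lborel)"
proof -
  have "(\<integral>\<^sup>+x. f x \<partial>lborel) = (\<integral>\<^sup>+x. f x \<partial>distr lborel borel (\<lambda>x. t - x))"
    using lborel_affine[of "-1" t] by (simp add: density_1)
  also have "\<dots> = (\<integral>\<^sup>+x. f (t - x) \<partial>lborel)"
    by (subst nn_integral_distr) auto
  finally show ?thesis by simp
qed

text \<open>
  Both sides evaluate the double integral of \<open>1\<^sub>A(g x) 1\<^sub>B(g x + y)\<close>, as in the proof that
  Haar measure is unique.
\<close>
lemma emeasure_lborel_vimage_linear_mult: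
  fixes g :: "'a::euclidean_space \<Rightarrow> 'a"
  assumes g: "linear g" "surj g" and AB: "A \<in> sets borel" "B \<in> sets borel"
  shows "emeasure lborel (g -` A) * emeasure lborel B = emeasure lborel (g -` B) * emeasure lborel A"
proof -
  note [measurable] = AB
  have [measurable]: "g \<in> borel \<rightarrow>\<^sub>M borel" using g(1) by (rule borel_measurable_linear)
  have m: "g -` C \<in> sets lborel" if "C \<in> sets borel" for C
    using measurable_sets[OF \<open>g \<in> borel \<rightarrow>\<^sub>M borel\<close> that] by simp
  have ind: "(\<integral>\<^sup>+x. indicator C (g x) \<partial>lborel) = emeasure lborel (g -` C)" if "C \<in> sets borel" for C
    using m[OF that] by (simp flip: nn_integral_indicator add: indicator_vimage)
  let ?I = "\<lambda>x y. indicator A (g x) * indicator B (g x + y) :: ennreal"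
  have "emeasure lborel (g -` A) * emeasure lborel B
      = (\<integral>\<^sup>+x. indicator A (g x) * (\<integral>\<^sup>+y. indicator B (g x + y) \<partial>lborel) \<partial>lborel)"
    using AB by (simp add: nn_integral_lborel_translate nn_integral_multc ind)
  also have "\<dots> = (\<integral>\<^sup>+x. (\<integral>\<^sup>+y. ?I x y \<partial>lborel) \<partial>lborel)"
    by (simp add: nn_integral_cmult)
  also have "\<dots> = (\<integral>\<^sup>+y. (\<integral>\<^sup>+x. ?I x y \<partial>lborel) \<partial>lborel)"
    by (rule lborel_pair.Fubini') measurable
  also have "\<dots> = (\<integral>\<^sup>+y. (\<integral>\<^sup>+x. indicator B (g x) * indicator A (g x - y) \<partial>lborel) \<partial>lborel)"
  proof (rule nn_integral_cong)
    fix y :: 'a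
    \<comment> \<open>Surjectivity turns the shift by \<open>y\<close> in the target into a shift by
      \<open>u\<close> in the source; translating \<open>x\<close> by \<open>- u\<close> then moves
      the shift from the factor of \<open>B\<close> to that of \<open>A\<close>.\<close>
    obtain u where u: "y = g u" using g(2) by auto
    have "(\<integral>\<^sup>+x. ?I x y \<partial>lborel) = (\<integral>\<^sup>+x. ?I (- u + x) y \<partial>lborel)"
      by (rule nn_integral_lborel_translate[symmetric]) measurable
    also have "\<dots> = (\<integral>\<^sup>+x. indicator B (g x) * indicator A (g x - y) \<partial>lborel)"
      using g(1) by (intro nn_integral_cong) (simp add: u linear_add linear_diff linear_neg mult.commute)
    finally show "(\<integral>\<^sup>+x. ?I x y \<partial>lborel) = \<dots>" .
  qed
  also have "\<dots> = (\<integral>\<^sup>+x. (\<integral>\<^sup>+y. indicator B (g x) * indicator A (g x - y) \<partial>lborel) \<partial>lborel)"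
    by (rule lborel_pair.Fubini'[symmetric]) measurable
  also have "\<dots> = (\<integral>\<^sup>+x. indicator B (g x) * (\<integral>\<^sup>+y. indicator A (g x - y) \<partial>lborel) \<partial>lborel)"
    by (simp add: nn_integral_cmult)
  also have "\<dots> = emeasure lborel (g -` B) * emeasure lborel A"
    using AB by (simp add: nn_integral_lborel_reflect nn_integral_multc ind)
  finally show ?thesis .
qed

lemma vimage_ball_orthogonal_transformation:
  assumes "orthogonal_transformation g"
  shows "g -` ball 0 r = ball 0 r"
  using assms by (auto simp: orthogonal_transformation_norm)

text \<open>Allows cancelling the ball as a factor in \<open>ennreal\<close> and makes the uniform
  measure on it a probability measure.\<close>

lemma emeasure_lborel_unit_ball:
  shows "emeasure lborel (ball (0::'a::euclidean_space) 1) \<noteq> 0"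
    and "emeasure lborel (ball (0::'a) 1) \<noteq> \<infinity>"
  using content_ball_pos[of 1 "0::'a"]
  by (auto simp: measure_def emeasure_lborel_ball_finite less_top[symmetric])

text \<open>The product identity says that taking preimages scales volume by a constant; the unit
  ball is its own preimage, so the constant is 1.\<close>

lemma emeasure_lborel_vimage_orthogonal_transformation:
  fixes g :: "'a::euclidean_space \<Rightarrow> 'a"
  assumes g: "orthogonal_transformation g" and A: "A \<in> sets borel"
  shows "emeasure lborel (g -` A) = emeasure lborel A"
proof -
  have "emeasure lborel (g -` A) * emeasure lborel (ball (0::'a) 1)
      = emeasure lborel A * emeasure lborel (ball (0::'a) 1)"
    using emeasure_lborel_vimage_linear_mult[of g A "ball 0 1"] g A
    by (simp add: orthogonal_transformation_linear orthogonal_transformation_surj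
        vimage_ball_orthogonal_transformation mult.commute)
  then show ?thesis
    using emeasure_lborel_unit_ball[where 'a = 'a]
    by (auto simp: ennreal_mult_cancel_left mult.commute[of _ "emeasure lborel (ball (0::'a) 1)"])
qed

section \<open>From the uniform measure on the ball to an invariant measure on the sphere\<close>

lemma distr_uniform_measure_ball_orthogonal_transformation:
  fixes g :: "'a::euclidean_space \<Rightarrow> 'a"
  assumes g: "orthogonal_transformation g"
  shows "distr (uniform_measure lborel (ball 0 1)) borel g = uniform_measure lborel (ball 0 1)"
    (is "distr ?U _ _ = _")
proof (rule measure_eqI)
  have [measurable]: "g \<in> borel \<rightarrow>\<^sub>M borel"
    using g by (intro borel_measurable_linear orthogonal_transformation_linear)
  fix A assume "A \<in> sets (distr ?U borel g)"
  then have A[measurable]: "A \<in> sets borel" by simp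
  have m: "g -` A \<in> sets borel"
    using measurable_sets[OF \<open>g \<in> borel \<rightarrow>\<^sub>M borel\<close> A] by simp
  have "emeasure lborel (ball 0 1 \<inter> g -` A) = emeasure lborel (g -` (ball 0 1 \<inter> A))"
    by (simp add: vimage_ball_orthogonal_transformation[OF g])
  also have "\<dots> = emeasure lborel (ball 0 1 \<inter> A)"
    by (rule emeasure_lborel_vimage_orthogonal_transformation[OF g]) measurable
  finally show "emeasure (distr ?U borel g) A = emeasure ?U A"
    using m by (simp add: emeasure_distr)
qed simp

text \<open>
  The witness is the radial projection of the uniform distribution on the unit ball; its value at
  the origin is irrelevant as long as it lies on the sphere.
\<close>
lemma ex_rotation_invariant_prob_on_sphere:
  assumes "r \<ge> 0"
  obtains \<omega> :: "(real^'n::finite) measure" where "rotation_invariant_prob_on_sphere r \<omega>"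
proof -
  define U :: "(real^'n) measure" where "U = uniform_measure lborel (ball 0 1)"
  define S :: "(real^'n) measure" where "S = restrict_space borel (sphere 0 r)"
  define e :: "real^'n" where "e = axis undefined 1"
  define p where "p x = (if x = 0 then r *\<^sub>R e else (r / norm x) *\<^sub>R x)" for x :: "real^'n"
  interpret U: prob_space U
    unfolding U_def by (intro prob_space_uniform_measure emeasure_lborel_unit_ball)
  have [measurable_cong]: "sets U = sets borel" by (simp add: U_def)
  have "norm (p x) = r" for x using assms by (simp add: p_def e_def norm_axis_1)
  moreover have "p \<in> borel \<rightarrow>\<^sub>M borel" unfolding p_def by measurable
  ultimately have [measurable]: "p \<in> U \<rightarrow>\<^sub>M S" "p \<in> borel \<rightarrow>\<^sub>M S"
    unfolding S_def U_def by (auto intro!: measurable_restrict_space2)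
  have "distr (distr U S p) (distr U S p) g = distr U S p" if g: "orthogonal_transformation g" for g
  proof -
    have gm[measurable]: "g \<in> borel \<rightarrow>\<^sub>M borel"
      using g by (intro borel_measurable_linear orthogonal_transformation_linear)
    have [measurable]: "g \<in> S \<rightarrow>\<^sub>M S"
      unfolding S_def using g
      by (intro measurable_restrict_space2 measurable_restrict_space1 gm)
        (auto simp: space_restrict_space orthogonal_transformation_norm)
    \<comment> \<open>\<open>p\<close> commutes with \<open>g\<close> away from the origin, where
      its value was fixed by hand; the origin is a null set, so the two push-forwards still
      agree.\<close>
    have "AE x in U. x \<noteq> 0"
      unfolding U_def by (intro AE_uniform_measureI) (auto intro!: AE_I'[of "{0}"])
    then have ae: "AE x in U. (g \<circ> p) x = (p \<circ> g) x"
    proof eventually_elim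
      case (elim x)
      have "norm (g x) = norm x" using g by (rule orthogonal_transformation_norm)
      moreover from this have "g x \<noteq> 0" using elim by auto
      ultimately show ?case using elim g by (simp add: p_def linear_cmul orthogonal_transformation_linear)
    qed
    have "distr (distr U S p) (distr U S p) g = distr (distr U S p) S g" by (rule distr_cong) auto
    also have "\<dots> = distr U S (g \<circ> p)" by (rule distr_distr) measurable
    also have "\<dots> = distr U S (p \<circ> g)" by (rule distr_cong_AE[OF refl refl ae]) measurable
    also have "\<dots> = distr (distr U borel g) S p" by (rule distr_distr[symmetric]) measurable
    also have "distr U borel g = U"
      unfolding U_def by (rule distr_uniform_measure_ball_orthogonal_transformation[OF g])
    finally show ?thesis .
  qed
  then have "rotation_invariant_prob_on_sphere r (distr U S p)"
    unfolding rotation_invariant_prob_on_sphere_def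
    using \<open>p \<in> U \<rightarrow>\<^sub>M S\<close> by (auto simp: S_def intro!: U.prob_space_distr)
  then show thesis by (rule that)
qed

section \<open>Spherical 1-designs\<close>

text \<open>The antipodal map is orthogonal and flips the sign of every coordinate, so the integral
  equals its own negative.\<close>

lemma rotation_invariant_integral_nth:
  fixes \<omega> :: "(real^'n::finite) measure"
  assumes "rotation_invariant_prob_on_sphere r \<omega>"
  shows "(\<integral>y. y $ i \<partial>\<omega>) = 0"
proof -
  have s[measurable_cong]: "sets \<omega> = sets (restrict_space borel (sphere 0 r))"
    and inv: "distr \<omega> \<omega> uminus = \<omega>"
    using assms orthogonal_transformation_neg[of "\<lambda>x::real^'n. x"]
    by (auto simp: rotation_invariant_prob_on_sphere_def)
  have "uminus \<in> restrict_space borel (sphere 0 r) \<rightarrow>\<^sub>M restrict_space borel (sphere (0::real^'n) r)"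
    by (intro measurable_restrict_space2 measurable_restrict_space1) (auto simp: space_restrict_space)
  then have [measurable]: "uminus \<in> \<omega> \<rightarrow>\<^sub>M \<omega>" by simp
  have [measurable]: "(\<lambda>y::real^'n. y $ i) \<in> borel_measurable \<omega>"
    by (simp add: measurable_restrict_space1 cong: measurable_cong_sets[OF s refl])
  have "(\<integral>y. y $ i \<partial>\<omega>) = (\<integral>y. y $ i \<partial>distr \<omega> \<omega> uminus)" by (simp add: inv)
  also have "\<dots> = - (\<integral>y. y $ i \<partial>\<omega>)" by (subst integral_distr) auto
  finally show ?thesis by simp
qed

lemma integrable_nth_on_sphere:
  fixes \<omega> :: "(real^'n::finite) measure"
  assumes "rotation_invariant_prob_on_sphere r \<omega>"
  shows "integrable \<omega> (\<lambda>y. y $ i)"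
proof -
  have s: "sets \<omega> = sets (restrict_space borel (sphere 0 r))"
    using assms by (auto simp: rotation_invariant_prob_on_sphere_def)
  interpret prob_space \<omega>
    using assms by (auto simp: rotation_invariant_prob_on_sphere_def)
  have "space \<omega> = sphere 0 r" using sets_eq_imp_space_eq[OF s] by (simp add: space_restrict_space)
  then show ?thesis
    by (intro integrable_const_bound[of _ r])
      (auto simp: measurable_restrict_space1 component_le_norm_cart cong: measurable_cong_sets[OF s refl]
        intro!: AE_I2 intro: order_trans[OF component_le_norm_cart])
qed

lemma nth_in_polys_of_degree_le_1: "(\<lambda>x::real^'n::finite. x $ i) \<in> polys_of_degree_le 1"
  unfolding polys_of_degree_le_def
  by (intro CollectI exI[of _ "{\<lambda>j. if j = i then 1 else 0}"] exI[of _ "\<lambda>_. 1"])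
    (auto simp: if_distrib[of "\<lambda>k. _ ^ k"] cong: if_cong)

text \<open>Natural exponents with sum at most 1 have at most one nonzero entry, which is then 1.
  Testing in degree 1 thus reduces to constants and coordinates.\<close>

lemma monomial_degree_le_1_cases:
  fixes a :: "'n::finite \<Rightarrow> nat"
  assumes "(\<Sum>i\<in>UNIV. a i) \<le> 1"
  obtains (const) "(\<lambda>x::real^'n. \<Prod>i\<in>UNIV. (x $ i) ^ a i) = (\<lambda>x. 1)"
    | (nth) i where "(\<lambda>x::real^'n. \<Prod>i\<in>UNIV. (x $ i) ^ a i) = (\<lambda>x. x $ i)"
proof (cases "\<forall>i. a i = 0")
  case True
  then show ?thesis by (intro const) simp
next
  case False
  then obtain i where "a i \<noteq> 0" by blast
  moreover have "(\<Sum>i\<in>UNIV. a i) = a i + sum a (UNIV - {i})" by (simp add: sum.remove)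
  ultimately have "a i = 1" "sum a (UNIV - {i}) = 0" using assms by linarith+
  then have "a = (\<lambda>j. if j = i then 1 else 0)" by (auto simp: fun_eq_iff)
  then show ?thesis
    by (intro nth[of i]) (simp add: if_distrib[of "\<lambda>k. _ ^ k"] cong: if_cong)
qed

text \<open>Constants pass the test by normalisation. Coordinates integrate to 0 over the sphere, so
  testing against all of them says that each component of the sum of \<open>x - z\<close>
  vanishes.\<close>

lemma spherical_design_1_iff:
  fixes z :: "real^'n::finite"
  shows "spherical_design 1 z r X \<longleftrightarrow>
    finite X \<and> X \<noteq> {} \<and> X \<subseteq> {x. norm (x - z) = r} \<and> (\<Sum>x\<in>X. x - z) = 0"
proof (intro iffI)
  assume D: "spherical_design 1 z r X"
  then obtain \<omega> where \<omega>: "rotation_invariant_prob_on_sphere r \<omega>"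
    and q: "\<And>q. q \<in> polys_of_degree_le 1 \<Longrightarrow>
      (\<integral>y. q y \<partial>\<omega>) = (1 / real (card X)) * (\<Sum>x\<in>X. q (x - z))"
    by (auto simp: spherical_design_def)
  have X: "finite X" "X \<noteq> {}" using D by (auto simp: spherical_design_def)
  have "(\<Sum>x\<in>X. x - z) $ i = 0" for i
    using q[OF nth_in_polys_of_degree_le_1] rotation_invariant_integral_nth[OF \<omega>] X by simp
  then show "finite X \<and> X \<noteq> {} \<and> X \<subseteq> {x. norm (x - z) = r} \<and> (\<Sum>x\<in>X. x - z) = 0"
    using D by (auto simp: spherical_design_def vec_eq_iff)
next
  assume *: "finite X \<and> X \<noteq> {} \<and> X \<subseteq> {x. norm (x - z) = r} \<and> (\<Sum>x\<in>X. x - z) = 0"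
  \<comment> \<open>A point of \<open>X\<close> forces \<open>r \<ge> 0\<close>; a sphere of
    negative radius is empty and carries no probability measure.\<close>
  then obtain x where "norm (x - z) = r" by blast
  then have "r \<ge> 0" by auto
  then obtain \<omega> :: "(real^'n) measure" where \<omega>: "rotation_invariant_prob_on_sphere r \<omega>"
    by (rule ex_rotation_invariant_prob_on_sphere)
  interpret prob_space \<omega> using \<omega> by (auto simp: rotation_invariant_prob_on_sphere_def)
  have "(\<integral>y. q y \<partial>\<omega>) = (1 / real (card X)) * (\<Sum>x\<in>X. q (x - z))"
    if pol: "q \<in> polys_of_degree_le 1" for q
  proof -
    let ?m = "\<lambda>a (x::real^'n). \<Prod>i\<in>UNIV. (x $ i) ^ a i"
    obtain A c where A: "finite A" "\<And>a. a \<in> A \<Longrightarrow> (\<Sum>i\<in>UNIV. a i) \<le> 1"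
      and q: "q = (\<lambda>x. \<Sum>a\<in>A. c a * ?m a x)"
      using pol unfolding polys_of_degree_le_def by blast
    have m: "integrable \<omega> (?m a) \<and> (\<integral>y. ?m a y \<partial>\<omega>) = (1 / real (card X)) * (\<Sum>x\<in>X. ?m a (x - z))"
      if "a \<in> A" for a
      using A(2)[OF that]
    proof (cases rule: monomial_degree_le_1_cases)
      case const
      then show ?thesis
        unfolding const fun_cong[OF const] using * by (simp add: prob_space)
    next
      case (nth i)
      have "(\<Sum>x\<in>X. (x - z) $ i) = (\<Sum>x\<in>X. x - z) $ i" by simp
      also have "\<dots> = 0" using * by simp
      finally show ?thesis
        unfolding nth fun_cong[OF nth]
        by (simp add: integrable_nth_on_sphere[OF \<omega>] rotation_invariant_integral_nth[OF \<omega>])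
    qed
    have "(\<integral>y. q y \<partial>\<omega>) = (\<Sum>a\<in>A. c a * (\<integral>y. ?m a y \<partial>\<omega>))"
      unfolding q using m by simp
    also have "\<dots> = (\<Sum>a\<in>A. \<Sum>x\<in>X. (1 / real (card X)) * (c a * ?m a (x - z)))"
      using m by (simp add: sum_distrib_left mult_ac)
    also have "\<dots> = (1 / real (card X)) * (\<Sum>x\<in>X. q (x - z))"
      unfolding q by (subst sum.swap) (simp add: sum_distrib_left)
    finally show ?thesis .
  qed
  with * \<omega> show "spherical_design 1 z r X"
    unfolding spherical_design_def by blast
qed

section \<open>Summability over uniformly discrete sets\<close>

text \<open>Translating by one of two points moves the pair to 0 and their difference, so the
  isolation radius at 0 serves everywhere.\<close>

lemma uniform_discrete_subgroup:
  fixes L :: "'a::real_normed_vector set"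
  assumes "0 \<in> L" and diff: "\<And>x y. x \<in> L \<Longrightarrow> y \<in> L \<Longrightarrow> x - y \<in> L" and "discrete L"
  shows "uniform_discrete L"
proof -
  obtain e where e: "e > 0" "\<And>y. y \<in> L \<Longrightarrow> dist 0 y < e \<Longrightarrow> y = 0"
    using assms by (meson discreteD isolated_inE_dist)
  show ?thesis
  proof (rule uniformI1[OF e(1)])
    fix x y assume "x \<in> L" "y \<in> L" "dist x y < e"
    then show "x = y" using e(2)[of "y - x"] diff by (simp add: dist_norm)
  qed
qed

text \<open>Makes the decay a product over coordinates, so that sums over grid boxes factor. The
  norm is at least the average of the absolute coordinates, hence the rate
  \<open>c / CARD('n)\<close> in each; rounding costs at most \<delta> per coordinate, which the
  leading factor pays for.\<close>

lemma exp_mult_norm_le_prod: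
  fixes x :: "real^'n::finite"
  assumes "c > 0" "\<delta> > 0"
  shows "exp (- c * norm x) \<le>
    (\<Prod>i\<in>UNIV. exp (c * \<delta> / CARD('n)) * exp (- (c * \<delta> / CARD('n))) ^ nat \<bar>\<lfloor>x $ i / \<delta>\<rfloor>\<bar>)"
proof -
  let ?b = "c * \<delta> / CARD('n)"
  have "(\<Sum>i\<in>UNIV. \<bar>x $ i\<bar>) \<le> (\<Sum>i\<in>(UNIV::'n set). norm x)"
    by (intro sum_mono component_le_norm_cart)
  then have 1: "(\<Sum>i\<in>UNIV. \<bar>x $ i\<bar>) / CARD('n) \<le> norm x" by (simp add: field_simps)
  have "?b * (\<bar>\<lfloor>x $ i / \<delta>\<rfloor>\<bar> - 1) \<le> c / CARD('n) * \<bar>x $ i\<bar>" for i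
  proof -
    have "real_of_int \<bar>\<lfloor>x $ i / \<delta>\<rfloor>\<bar> - 1 \<le> \<bar>x $ i / \<delta>\<bar>" by linarith
    then have "\<delta> * (\<bar>\<lfloor>x $ i / \<delta>\<rfloor>\<bar> - 1) \<le> \<bar>x $ i\<bar>" using assms by (simp add: field_simps abs_divide)
    then have "c / CARD('n) * (\<delta> * (\<bar>\<lfloor>x $ i / \<delta>\<rfloor>\<bar> - 1)) \<le> c / CARD('n) * \<bar>x $ i\<bar>"
      using assms by (intro mult_left_mono) auto
    then show ?thesis by (simp add: mult_ac)
  qed
  then have "(\<Sum>i\<in>UNIV. ?b * (\<bar>\<lfloor>x $ i / \<delta>\<rfloor>\<bar> - 1)) \<le> (\<Sum>i\<in>UNIV. c / CARD('n) * \<bar>x $ i\<bar>)"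
    by (intro sum_mono) auto
  also have "\<dots> \<le> c * norm x"
    using mult_left_mono[OF 1, of c] assms by (simp add: sum_distrib_left sum_divide_distrib)
  finally have "exp (- c * norm x) \<le> exp (\<Sum>i\<in>UNIV. ?b - ?b * \<bar>\<lfloor>x $ i / \<delta>\<rfloor>\<bar>)"
    by (simp add: algebra_simps sum_subtractf)
  also have "\<dots> = (\<Prod>i\<in>UNIV. exp ?b * exp (- ?b) ^ nat \<bar>\<lfloor>x $ i / \<delta>\<rfloor>\<bar>)"
  proof -
    have "exp (b - b * \<bar>real_of_int m\<bar>) = exp b * exp (- b) ^ nat \<bar>m\<bar>" for b m
    proof -
      have "exp (- b) ^ nat \<bar>m\<bar> = exp (- (b * real_of_int \<bar>m\<bar>))"
        by (simp add: mult.commute flip: exp_of_nat_mult)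
      then show ?thesis by (simp flip: exp_add)
    qed
    then show ?thesis by (simp only: exp_sum[OF finite] of_int_abs)
  qed
  finally show ?thesis .
qed

text \<open>
  Rounding to a grid of mesh \<open>\<delta>\<close> with \<open>\<delta> n < e\<close> is injective on an \<open>e\<close>-separated set, which
  reduces the claim to a product of geometric series.
\<close>
lemma summable_on_exp_norm:
  fixes X :: "(real^'n::finite) set"
  assumes "uniform_discrete X" "c > 0"
  shows "(\<lambda>x. exp (- c * norm x)) summable_on X"
proof -
  obtain e where e: "e > 0" "\<And>x y. x \<in> X \<Longrightarrow> y \<in> X \<Longrightarrow> dist x y < e \<Longrightarrow> x = y"
    using assms unfolding uniform_discrete_def by blast
  define \<delta> where "\<delta> = e / (2 * CARD('n))"
  have \<delta>: "\<delta> > 0" using e by (simp add: \<delta>_def)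
  define k where "k x = (\<lambda>i. \<lfloor>x $ i / \<delta>\<rfloor>)" for x :: "real^'n"
  have inj: "inj_on k X"
  proof (rule inj_onI)
    fix x y assume xy: "x \<in> X" "y \<in> X" "k x = k y"
    have "\<bar>(x - y) $ i\<bar> \<le> \<delta>" for i
    proof -
      have "\<lfloor>x $ i / \<delta>\<rfloor> = \<lfloor>y $ i / \<delta>\<rfloor>" using xy by (simp add: k_def fun_eq_iff)
      then have "\<bar>x $ i / \<delta> - y $ i / \<delta>\<bar> \<le> 1" by linarith
      then have "\<bar>(x - y) $ i / \<delta>\<bar> \<le> 1" by (simp add: diff_divide_distrib)
      then show ?thesis using \<delta> by (simp add: abs_divide)
    qed
    then have "(\<Sum>i\<in>UNIV. \<bar>(x - y) $ i\<bar>) \<le> (\<Sum>i\<in>(UNIV::'n set). \<delta>)"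
      by (intro sum_mono)
    then have "norm (x - y) \<le> e / 2"
      using norm_le_l1_cart[of "x - y"] by (simp add: \<delta>_def)
    then show "x = y" using e xy by (simp add: dist_norm)
  qed
  define q where "q = exp (- (c * \<delta> / CARD('n)))"
  define h where "h m = exp (c * \<delta> / CARD('n)) * q ^ nat \<bar>m\<bar>" for m :: int
  have q: "0 < q" "q < 1" using assms \<delta> by (auto simp: q_def)
  have h0: "h m \<ge> 0" for m using q by (simp add: h_def)
  have "summable (\<lambda>n. h (int n))" "summable (\<lambda>n. h (- int n))"
    using q by (auto simp: h_def intro!: summable_mult)
  then have "h summable_on range int" "h summable_on range (\<lambda>n. - int n)"
    by (auto simp: summable_on_reindex inj_def o_def h0 summable_nonneg_imp_summable_on)
  then have "h summable_on (range int \<union> range (\<lambda>n. - int n))"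
    by (rule summable_on_union)
  moreover have "range int \<union> range (\<lambda>n. - int n) = UNIV"
    by (auto simp: image_iff) (metis int_cases2)
  ultimately have h: "h summable_on UNIV" by simp
  have "(\<Sum>x\<in>F. exp (- c * norm x)) \<le> (infsum h UNIV) ^ CARD('n)" if F: "F \<subseteq> X" "finite F" for F
  proof -
    \<comment> \<open>\<open>B\<close> collects all coordinates of the occurring grid points. Since
      \<open>h\<close> is nonnegative, the sum may be enlarged to the full box over
      \<open>B\<close>, where the sum of products becomes a product of sums.\<close>
    define B where "B = (\<Union>x\<in>F. range (k x))"
    have B: "finite B" using F by (auto simp: B_def)
    have "(\<Sum>x\<in>F. exp (- c * norm x)) \<le> (\<Sum>x\<in>F. \<Prod>i\<in>UNIV. h (k x i))"
      using exp_mult_norm_le_prod[OF assms(2) \<delta>] by (intro sum_mono) (simp add: h_def k_def q_def)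
    also have "\<dots> = (\<Sum>g\<in>k ` F. \<Prod>i\<in>UNIV. h (g i))"
      using inj F(1) by (simp add: sum.reindex inj_on_subset)
    also have "\<dots> \<le> (\<Sum>g\<in>PiE (UNIV::'n set) (\<lambda>_. B). \<Prod>i\<in>UNIV. h (g i))"
      by (rule sum_mono2) (use B in \<open>auto simp: B_def h0 intro!: prod_nonneg finite_PiE\<close>)
    also have "\<dots> = (\<Prod>i\<in>(UNIV::'n set). \<Sum>m\<in>B. h m)"
      using B by (intro prod_sum_PiE[symmetric]) auto
    also have "\<dots> = (\<Sum>m\<in>B. h m) ^ CARD('n)" by simp
    also have "\<dots> \<le> (infsum h UNIV) ^ CARD('n)"
      using B h h0 by (intro power_mono finite_sum_le_infsum sum_nonneg) auto
    finally show ?thesis .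
  qed
  then show ?thesis by (intro nonneg_bdd_above_summable_on bdd_aboveI2) auto
qed

text \<open>The linear term allows one statement to cover the potential
  (\<open>\<beta> = 0\<close>), its gradient (\<open>\<beta> = 1\<close>) and the Taylor remainder
  (\<open>\<beta> = 2 * \<alpha> + 4\<close>).\<close>

lemma summable_on_gaussian:
  fixes X :: "(real^'n::finite) set"
  assumes "uniform_discrete X" "\<alpha> > 0"
  shows "(\<lambda>x. exp (\<beta> * norm (x - z) - \<alpha> * (norm (x - z))\<^sup>2)) summable_on X"
proof -
  \<comment> \<open>The quotient is the maximum of
    \<open>(\<beta> + 1) * t - \<alpha> * t\<^sup>2\<close>; raising \<beta> by 1 leaves a decay
    \<open>exp (- t)\<close>, and \<open>norm z\<close> pays for passing from
    \<open>norm (x - z)\<close> to \<open>norm x\<close>.\<close>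
  define K where "K = exp ((\<beta> + 1)\<^sup>2 / (4 * \<alpha>) + norm z)"
  have "norm (exp (\<beta> * norm (x - z) - \<alpha> * (norm (x - z))\<^sup>2)) \<le> K * exp (- 1 * norm x)" for x
  proof -
    define t where "t = norm (x - z)"
    have "0 \<le> (2 * \<alpha> * t - (\<beta> + 1))\<^sup>2 / (4 * \<alpha>)" using assms by simp
    also have "\<dots> = \<alpha> * t\<^sup>2 - (\<beta> + 1) * t + (\<beta> + 1)\<^sup>2 / (4 * \<alpha>)"
      using assms by (simp add: field_simps power2_eq_square)
    finally have "\<beta> * t - \<alpha> * t\<^sup>2 \<le> (\<beta> + 1)\<^sup>2 / (4 * \<alpha>) - t" by (simp add: algebra_simps)
    moreover have "norm x \<le> t + norm z" unfolding t_def by (metis diff_add_cancel norm_triangle_ineq)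
    ultimately show ?thesis by (simp add: K_def t_def flip: exp_add)
  qed
  then have "(\<lambda>x. norm (exp (\<beta> * norm (x - z) - \<alpha> * (norm (x - z))\<^sup>2))) summable_on X"
  proof (rule Infinite_Sum.abs_summable_on_comparison_test'[rotated])
    show "(\<lambda>x. K * exp (- 1 * norm x)) summable_on X"
      by (intro summable_on_cmult_right summable_on_exp_norm assms) auto
  qed
  then show ?thesis by simp
qed

section \<open>The gradient of the Gaussian potential\<close>

lemma exp_second_order_bound:
  fixes s :: real
  shows "\<bar>exp s - 1 - s\<bar> \<le> s\<^sup>2 * exp \<bar>s\<bar>"
proof -
  obtain t where t: "\<bar>t\<bar> \<le> \<bar>s\<bar>" "exp s = (\<Sum>m<2. s ^ m / fact m) + exp t / fact 2 * s ^ 2"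
    using Maclaurin_exp_le[of s 2] by blast
  then have "exp s - 1 - s = exp t / 2 * s\<^sup>2" by (simp add: numeral_2_eq_2)
  also have "\<bar>\<dots>\<bar> \<le> exp \<bar>s\<bar> * s\<^sup>2"
  proof -
    have "exp t \<le> exp \<bar>s\<bar>" using t by simp
    then have "exp t / 2 \<le> exp \<bar>s\<bar>" using exp_ge_zero[of t] by linarith
    then show ?thesis unfolding abs_mult by (intro mult_mono) auto
  qed
  finally show ?thesis by (simp add: mult.commute)
qed

text \<open>A first order expansion in \<open>h\<close> whose error is quadratic in \<open>h\<close>
  with a coefficient summable over the points \<open>y\<close>. Powers of \<open>norm y\<close> are
  traded for exponentials to reach the form of \<open>summable_on_gaussian\<close>.\<close>

lemma gaussian_translate_remainder:
  fixes y h :: "'a::real_inner"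
  assumes "\<alpha> > 0" "norm h \<le> 1"
  shows "\<bar>exp (- \<alpha> * (norm (y - h))\<^sup>2) - exp (- \<alpha> * (norm y)\<^sup>2) - 2 * \<alpha> * exp (- \<alpha> * (norm y)\<^sup>2) * (h \<bullet> y)\<bar>
    \<le> (norm h)\<^sup>2 * ((\<alpha>\<^sup>2 + \<alpha>) * exp (\<alpha> + 2) * exp ((2 * \<alpha> + 4) * norm y - \<alpha> * (norm y)\<^sup>2))"
proof -
  \<comment> \<open>\<open>s\<close> is the exact change of the exponent under the shift, and
    \<open>u\<close> controls it linearly in \<open>norm h\<close>; the summand 1 absorbs the
    quadratic term, as \<open>norm h \<le> 1\<close>. The final constants arise from expanding
    \<open>(\<alpha> + 2) * u\<close>.\<close>
  define u where "u = 2 * norm y + 1"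
  define s where "s = 2 * \<alpha> * (h \<bullet> y) - \<alpha> * (norm h)\<^sup>2"
  have "\<bar>s\<bar> \<le> 2 * \<alpha> * (norm h * norm y) + \<alpha> * (norm h * 1)"
  proof -
    have "\<bar>2 * \<alpha> * (h \<bullet> y)\<bar> \<le> 2 * \<alpha> * (norm h * norm y)"
      using Cauchy_Schwarz_ineq2[of h y] assms by (simp add: abs_mult)
    moreover have "\<alpha> * (norm h)\<^sup>2 \<le> \<alpha> * (norm h * 1)"
      unfolding power2_eq_square using assms by (intro mult_left_mono) auto
    moreover have "0 \<le> \<alpha> * (norm h)\<^sup>2" using assms by simp
    ultimately show ?thesis unfolding s_def by linarith
  qed
  also have "\<dots> = \<alpha> * u * norm h" by (simp add: u_def algebra_simps)
  finally have s: "\<bar>s\<bar> \<le> \<alpha> * u * norm h" .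
  have u: "u \<ge> 1" by (simp add: u_def)
  have "\<alpha> * u * norm h \<le> \<alpha> * u * 1" using assms u by (intro mult_left_mono) auto
  with s have s1: "\<bar>s\<bar> \<le> \<alpha> * u" by linarith
  have "s\<^sup>2 \<le> (\<alpha> * u * norm h)\<^sup>2" using s by (intro abs_le_square_iff[THEN iffD1]) linarith
  then have s2: "s\<^sup>2 \<le> \<alpha>\<^sup>2 * u\<^sup>2 * (norm h)\<^sup>2" by (simp add: power_mult_distrib)
  have "u \<le> exp u" using exp_ge_add_one_self[of u] by linarith
  then have "u\<^sup>2 \<le> (exp u)\<^sup>2" using u by (intro power_mono) auto
  then have u2: "u\<^sup>2 \<le> exp (2 * u)" by (simp add: power2_eq_square flip: exp_add)
  have E: "exp (- \<alpha> * (norm (y - h))\<^sup>2) = exp (- \<alpha> * (norm y)\<^sup>2) * exp s"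
    unfolding s_def by (simp add: power2_norm_eq_inner inner_diff inner_commute algebra_simps flip: exp_add)
  \<comment> \<open>The linear term \<open>2 * \<alpha> * (h \<bullet> y)\<close> is
    \<open>s\<close> plus \<open>\<alpha> * (norm h)\<^sup>2\<close>; the latter is the separate
    correction.\<close>
  have "exp (- \<alpha> * (norm (y - h))\<^sup>2) - exp (- \<alpha> * (norm y)\<^sup>2) - 2 * \<alpha> * exp (- \<alpha> * (norm y)\<^sup>2) * (h \<bullet> y)
      = exp (- \<alpha> * (norm y)\<^sup>2) * ((exp s - 1 - s) - \<alpha> * (norm h)\<^sup>2)"
    unfolding E by (simp add: s_def algebra_simps)
  also have "\<bar>\<dots>\<bar> = exp (- \<alpha> * (norm y)\<^sup>2) * \<bar>(exp s - 1 - s) - \<alpha> * (norm h)\<^sup>2\<bar>"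
    by (simp add: abs_mult)
  also have "\<dots> \<le> exp (- \<alpha> * (norm y)\<^sup>2) * ((norm h)\<^sup>2 * ((\<alpha>\<^sup>2 + \<alpha>) * exp ((\<alpha> + 2) * u)))"
  proof (rule mult_left_mono)
    have "\<bar>(exp s - 1 - s) - \<alpha> * (norm h)\<^sup>2\<bar> \<le> s\<^sup>2 * exp \<bar>s\<bar> + \<alpha> * (norm h)\<^sup>2"
      using exp_second_order_bound[of s] assms by (smt (verit) mult_nonneg_nonneg zero_le_power2)
    also have "s\<^sup>2 * exp \<bar>s\<bar> \<le> (\<alpha>\<^sup>2 * exp (2 * u) * (norm h)\<^sup>2) * exp (\<alpha> * u)"
      using s1 by (intro mult_mono order_trans[OF s2] mult_right_mono mult_left_mono u2) auto
    also have "\<dots> = (norm h)\<^sup>2 * (\<alpha>\<^sup>2 * exp ((\<alpha> + 2) * u))"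
      by (simp add: algebra_simps exp_add)
    also have "\<alpha> * (norm h)\<^sup>2 \<le> (norm h)\<^sup>2 * (\<alpha> * exp ((\<alpha> + 2) * u))"
      using assms u mult_left_mono[of 1 "exp ((\<alpha> + 2) * u)" "(norm h)\<^sup>2 * \<alpha>"] by (simp add: mult_ac)
    finally show "\<bar>(exp s - 1 - s) - \<alpha> * (norm h)\<^sup>2\<bar> \<le> (norm h)\<^sup>2 * ((\<alpha>\<^sup>2 + \<alpha>) * exp ((\<alpha> + 2) * u))"
      by (simp add: algebra_simps)
  qed simp
  also have "\<dots> = (norm h)\<^sup>2 * ((\<alpha>\<^sup>2 + \<alpha>) * (exp ((\<alpha> + 2) * u) * exp (- \<alpha> * (norm y)\<^sup>2)))"
    by (simp add: mult_ac)
  also have "exp ((\<alpha> + 2) * u) * exp (- \<alpha> * (norm y)\<^sup>2) = exp (\<alpha> + 2) * exp ((2 * \<alpha> + 4) * norm y - \<alpha> * (norm y)\<^sup>2)"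
    unfolding u_def by (simp add: algebra_simps flip: exp_add)
  finally show ?thesis by (simp add: mult.assoc)
qed

lemma abs_summable_on_gaussian_gradient:
  fixes X :: "(real^'n::finite) set"
  assumes "uniform_discrete X" "\<alpha> > 0"
  shows "(\<lambda>x. norm (exp (- \<alpha> * (norm (x - z))\<^sup>2) *\<^sub>R (x - z))) summable_on X"
proof (rule Infinite_Sum.abs_summable_on_comparison_test'[OF summable_on_gaussian[OF assms, of 1 z]])
  fix x :: "real^'n"
  have "norm (x - z) \<le> exp (norm (x - z))"
    using exp_ge_add_one_self[of "norm (x - z)"] by linarith
  then show "norm (exp (- \<alpha> * (norm (x - z))\<^sup>2) *\<^sub>R (x - z))
      \<le> exp (1 * norm (x - z) - \<alpha> * (norm (x - z))\<^sup>2)"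
    by (simp add: exp_diff exp_minus divide_inverse)
qed

text \<open>Summing the remainder bounds over \<open>X\<close> gives a total error of at most
  \<open>(norm h)\<^sup>2 * C\<close>, which is differentiability at \<open>z\<close> without
  exchanging a limit with the series.\<close>

lemma GDERIV_potential:
  fixes X :: "(real^'n::finite) set"
  assumes X: "uniform_discrete X" "\<alpha> > 0"
  shows "GDERIV (potential (f_exp \<alpha>) X) z :>
    (2 * \<alpha>) *\<^sub>R (\<Sum>\<^sub>\<infinity>x\<in>X. exp (- \<alpha> * (norm (x - z))\<^sup>2) *\<^sub>R (x - z))"
proof -
  let ?e = "\<lambda>w x. exp (- \<alpha> * (norm (x - w))\<^sup>2)"
  let ?g = "\<lambda>x. ?e z x *\<^sub>R (x - z)"
  define G where "G = infsum ?g X"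
  define K where "K x = (\<alpha>\<^sup>2 + \<alpha>) * exp (\<alpha> + 2) * exp ((2 * \<alpha> + 4) * norm (x - z) - \<alpha> * (norm (x - z))\<^sup>2)" for x
  define C where "C = infsum K X"
  \<comment> \<open>\<open>infsum\<close> defaults to 0 on families that are not summable, so
    summability is secured at every \<open>w\<close>, including the displaced points
    \<open>z + h\<close>.\<close>
  have e: "(?e w) summable_on X" for w using summable_on_gaussian[OF X, of 0 w] by simp
  have K: "(K has_sum C) X"
    unfolding C_def K_def by (intro has_sum_infsum summable_on_cmult_right summable_on_gaussian X)
  have g: "(?g has_sum G) X"
    unfolding G_def
    by (intro has_sum_infsum)
      (rule Infinite_Sum.abs_summable_summable[OF abs_summable_on_gaussian_gradient[OF X]])
  have R: "\<bar>potential (f_exp \<alpha>) X (z + h) - potential (f_exp \<alpha>) X z - h \<bullet> ((2 * \<alpha>) *\<^sub>R G)\<bar> \<le> (norm h)\<^sup>2 * C"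
    if h: "norm h \<le> 1" for h
  proof -
    have pot: "((?e w) has_sum potential (f_exp \<alpha>) X w) X" for w
      using e[of w] by (simp add: potential_def f_exp_def)
    have "((\<lambda>x. h \<bullet> ((2 * \<alpha>) *\<^sub>R ?g x)) has_sum h \<bullet> ((2 * \<alpha>) *\<^sub>R G)) X"
      by (rule has_sum_bounded_linear[OF _ g])
        (intro bounded_linear_compose[OF bounded_linear_inner_right] bounded_linear_scaleR_right)
    then have "((\<lambda>x. ?e (z + h) x + (- 1) * ?e z x + (- 1) * (h \<bullet> ((2 * \<alpha>) *\<^sub>R ?g x))) has_sum
        (potential (f_exp \<alpha>) X (z + h) + (- 1) * potential (f_exp \<alpha>) X z + (- 1) * (h \<bullet> ((2 * \<alpha>) *\<^sub>R G)))) X"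
      by (intro has_sum_add has_sum_cmult_right pot)
    moreover have "((\<lambda>x. (norm h)\<^sup>2 * K x) has_sum (norm h)\<^sup>2 * C) X"
      by (rule has_sum_cmult_right[OF K])
    moreover have "norm (?e (z + h) x + (- 1) * ?e z x + (- 1) * (h \<bullet> ((2 * \<alpha>) *\<^sub>R ?g x))) \<le> (norm h)\<^sup>2 * K x" for x
      using gaussian_translate_remainder[OF X(2) h, of "x - z"]
      by (simp add: K_def diff_diff_eq mult_ac)
    ultimately show ?thesis
      using norm_infsum_le by fastforce
  qed
  have "(potential (f_exp \<alpha>) X has_derivative (\<lambda>h. h \<bullet> ((2 * \<alpha>) *\<^sub>R G))) (at z)"
  proof (rule has_derivativeI_sandwich[of 1])
    show "norm (potential (f_exp \<alpha>) X y - potential (f_exp \<alpha>) X z - (y - z) \<bullet> ((2 * \<alpha>) *\<^sub>R G)) / norm (y - z)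
        \<le> norm (y - z) * C" if "y \<noteq> z" "dist y z < 1" for y
      using R[of "y - z"] that by (simp add: dist_norm field_simps power2_eq_square)
    have "((\<lambda>y. norm (y - z) * C) \<longlongrightarrow> norm (z - z) * C) (at z)" by (intro tendsto_intros)
    then show "((\<lambda>y. norm (y - z) * C) \<longlongrightarrow> 0) (at z)" by simp
  qed (rule zero_less_one, rule bounded_linear_inner_left)
  then show ?thesis by (simp add: gderiv_def G_def)
qed

lemma critical_point_potential_iff:
  fixes X :: "(real^'n::finite) set"
  assumes X: "uniform_discrete X" "\<alpha> > 0"
  shows "critical_point (potential (f_exp \<alpha>) X) z \<longleftrightarrow>
    (\<Sum>\<^sub>\<infinity>x\<in>X. exp (- \<alpha> * (norm (x - z))\<^sup>2) *\<^sub>R (x - z)) = 0" (is "_ \<longleftrightarrow> ?G = 0")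
proof
  assume "critical_point (potential (f_exp \<alpha>) X) z"
  then have "(\<lambda>h. h \<bullet> ((2 * \<alpha>) *\<^sub>R ?G)) = (\<lambda>h. h \<bullet> 0)"
    using GDERIV_potential[OF X, of z] unfolding critical_point_def gderiv_def
    by (rule has_derivative_unique[rotated])
  \<comment> \<open>Evaluating the zero derivative at the gradient direction itself yields a
    positive multiple of the squared norm of \<open>?G\<close>.\<close>
  from fun_cong[OF this, of ?G] show "?G = 0" using X by simp
next
  assume "?G = 0"
  then show "critical_point (potential (f_exp \<alpha>) X) z"
    using GDERIV_potential[OF X, of z] by (simp add: critical_point_def)
qed

section \<open>Shells and the equivalence\<close>

lemma finite_uniform_discrete_ball:
  fixes X :: "'a::euclidean_space set"
  assumes "uniform_discrete X"
  shows "finite {x \<in> X. norm (x - z) \<le> r}"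
proof -
  have "{x \<in> X. norm (x - z) \<le> r} \<subseteq> cball z r" by (auto simp: dist_norm norm_minus_commute)
  then have "bounded {x \<in> X. norm (x - z) \<le> r}" using bounded_cball bounded_subset by blast
  moreover have "uniform_discrete {x \<in> X. norm (x - z) \<le> r}"
    using assms by (rule uniform_discrete_subset) auto
  ultimately show ?thesis using uniform_discrete_finite_iff by blast
qed

lemma finite_shell:
  fixes X :: "'a::euclidean_space set"
  assumes "uniform_discrete X"
  shows "finite (shell X z r)"
  by (rule finite_subset[OF _ finite_uniform_discrete_ball[OF assms, of z r]]) (auto simp: shell_def)

text \<open>The weight is constant on each shell and factors out of its sum. \<open>P\<close>
  selects the radii, so that closed balls and open balls are both covered.\<close>

lemma sum_radial_eq_0:
  fixes z :: "'a::real_normed_vector"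
  assumes fin: "finite {x \<in> X. P (norm (x - z))}"
    and shells: "\<And>r. P r \<Longrightarrow> (\<Sum>x\<in>shell X z r. x - z) = 0"
  shows "(\<Sum>x | x \<in> X \<and> P (norm (x - z)). w (norm (x - z)) *\<^sub>R (x - z)) = 0"
proof -
  let ?Y = "{x \<in> X. P (norm (x - z))}"
  have "(\<Sum>x | x \<in> ?Y \<and> norm (x - z) = r. w (norm (x - z)) *\<^sub>R (x - z)) = 0"
    if "r \<in> (\<lambda>x. norm (x - z)) ` ?Y" for r
  proof -
    have "P r" and "{x. x \<in> ?Y \<and> norm (x - z) = r} = shell X z r" using that by (auto simp: shell_def)
    moreover have "(\<Sum>x\<in>shell X z r. w (norm (x - z)) *\<^sub>R (x - z)) = w r *\<^sub>R (\<Sum>x\<in>shell X z r. x - z)"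
      unfolding scaleR_sum_right by (intro sum.cong) (auto simp: shell_def)
    ultimately show ?thesis using shells by simp
  qed
  then show ?thesis
    by (subst sum.image_gen[OF fin, of _ "\<lambda>x. norm (x - z)"]) (rule sum.neutral, blast)
qed

text \<open>Closed balls around \<open>z\<close> meet \<open>X\<close> in finite sets that exhaust
  it, and the sums over them are already 0, so the limit is 0.\<close>

lemma has_sum_radial_eq_0:
  fixes X :: "'a::euclidean_space set"
  assumes X: "uniform_discrete X" and shells: "\<And>r. (\<Sum>x\<in>shell X z r. x - z) = 0"
    and S: "((\<lambda>x. w (norm (x - z)) *\<^sub>R (x - z)) has_sum S) X"
  shows "S = 0"
proof (rule ccontr)
  let ?f = "\<lambda>x. w (norm (x - z)) *\<^sub>R (x - z)"
  assume "S \<noteq> 0"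
  then have "\<forall>\<^sub>F F in finite_subsets_at_top X. dist (sum ?f F) S < norm S"
    using S unfolding has_sum_def by (intro tendstoD) auto
  then obtain F where F: "finite F" "F \<subseteq> X"
    and close: "\<forall>Y. finite Y \<and> F \<subseteq> Y \<and> Y \<subseteq> X \<longrightarrow> dist (sum ?f Y) S < norm S"
    unfolding eventually_finite_subsets_at_top by (elim exE conjE)
  \<comment> \<open>The sum of the radii bounds each of them and, unlike a maximum, makes sense for
    empty \<open>F\<close>.\<close>
  define R where "R = (\<Sum>x\<in>F. norm (x - z))"
  have "norm (x - z) \<le> R" if "x \<in> F" for x
    unfolding R_def using that F(1) by (intro member_le_sum) auto
  then have "dist (sum ?f {x \<in> X. norm (x - z) \<le> R}) S < norm S"
    using F by (intro close[rule_format] conjI finite_uniform_discrete_ball X) auto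
  then show False
    using sum_radial_eq_0[of X "\<lambda>s. s \<le> R" z w] finite_uniform_discrete_ball[OF X] shells by simp
qed

lemma radial_gap:
  fixes X :: "'a::euclidean_space set"
  assumes X: "uniform_discrete X"
  obtains \<delta> where "\<delta> > 0" "\<And>x. x \<in> X \<Longrightarrow> norm (x - z) > r \<Longrightarrow> norm (x - z) \<ge> r + \<delta>"
proof -
  \<comment> \<open>Inserting 1 keeps the minimum defined when no point has radius in the annulus,
    and caps the gap so that points beyond \<open>r + 1\<close> respect it too.\<close>
  define N where "N = insert 1 ((\<lambda>x. norm (x - z) - r) ` {x \<in> X. norm (x - z) \<le> r + 1 \<and> norm (x - z) > r})"
  have "finite {x \<in> X. norm (x - z) \<le> r + 1 \<and> norm (x - z) > r}"
    by (rule finite_subset[OF _ finite_uniform_discrete_ball[OF X, of z "r + 1"]]) auto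
  then have N: "finite N" "N \<noteq> {}"
    unfolding N_def by auto
  show thesis
  proof (rule that[of "Min N"])
    show "Min N > 0" using N by (subst Min_gr_iff) (auto simp: N_def)
    fix x assume x: "x \<in> X" "norm (x - z) > r"
    show "norm (x - z) \<ge> r + Min N"
    proof (cases "norm (x - z) \<le> r + 1")
      case True
      then have "norm (x - z) - r \<in> N" using x by (auto simp: N_def)
      then show ?thesis using Min_le[OF N(1)] by fastforce
    next
      case False
      have "Min N \<le> 1" using N by (intro Min_le) (auto simp: N_def)
      then show ?thesis using False by linarith
    qed
  qed
qed

text \<open>As \<open>\<alpha> \<rightarrow> \<infinity>\<close>, the gradient is dominated by the smallest unbalanced shell.\<close>
lemma shell_sum_eq_0:
  fixes X :: "(real^'n::finite) set"
  assumes X: "uniform_discrete X" and "\<alpha>\<^sub>0 > 0"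
    and grad: "\<And>\<alpha>. \<alpha> \<ge> \<alpha>\<^sub>0 \<Longrightarrow> (\<Sum>\<^sub>\<infinity>x\<in>X. exp (- \<alpha> * (norm (x - z))\<^sup>2) *\<^sub>R (x - z)) = 0"
  shows "(\<Sum>x\<in>shell X z r. x - z) = 0"
proof (rule ccontr)
  define v where "v r = (\<Sum>x\<in>shell X z r. x - z)" for r
  \<comment> \<open>An unbalanced shell is nonempty, and only finitely many points have radius at
    most \<open>r\<close>; the cut at \<open>r\<close> thus makes \<open>Bad\<close> finite and
    gives it a minimum.\<close>
  define Bad where "Bad = {s. s \<le> r \<and> v s \<noteq> 0}"
  assume "(\<Sum>x\<in>shell X z r. x - z) \<noteq> 0"
  then have "r \<in> Bad" by (simp add: Bad_def v_def)
  have "Bad \<subseteq> (\<lambda>x. norm (x - z)) ` {x \<in> X. norm (x - z) \<le> r}"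
  proof
    fix s assume "s \<in> Bad"
    then have "shell X z s \<noteq> {}" "s \<le> r" by (auto simp: Bad_def v_def)
    then show "s \<in> (\<lambda>x. norm (x - z)) ` {x \<in> X. norm (x - z) \<le> r}" by (auto simp: shell_def)
  qed
  then have "finite Bad" by (rule finite_subset) (intro finite_imageI finite_uniform_discrete_ball X)
  define m where "m = Min Bad"
  have "m \<in> Bad" unfolding m_def using \<open>finite Bad\<close> \<open>r \<in> Bad\<close> by (intro Min_in) auto
  then have vm: "v m \<noteq> 0" by (simp add: Bad_def)
  then have "shell X z m \<noteq> {}" by (auto simp: v_def)
  then have m0: "m \<ge> 0" by (auto simp: shell_def)
  have below: "v s = 0" if "s < m" for s
  proof (rule ccontr)
    assume "v s \<noteq> 0"
    then have "s \<in> Bad" using that \<open>m \<in> Bad\<close> by (auto simp: Bad_def)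
    then show False using Min_le[OF \<open>finite Bad\<close>] that by (fastforce simp: m_def)
  qed
  obtain \<delta> where \<delta>: "\<delta> > 0" "\<And>x. x \<in> X \<Longrightarrow> norm (x - z) > m \<Longrightarrow> norm (x - z) \<ge> m + \<delta>"
    using radial_gap[OF X, of m z] by blast
  define Y where "Y = {x \<in> X. norm (x - z) \<le> m}"
  have Y: "finite Y" "Y \<subseteq> X" unfolding Y_def using finite_uniform_discrete_ball[OF X] by auto
  let ?g = "\<lambda>\<alpha> x. exp (- \<alpha> * (norm (x - z))\<^sup>2) *\<^sub>R (x - z)"
  have abs: "(\<lambda>x. norm (?g \<alpha> x)) summable_on X - Y" if "\<alpha> \<ge> \<alpha>\<^sub>0" for \<alpha>
    by (rule abs_summable_on_gaussian_gradient) (use X that \<open>\<alpha>\<^sub>0 > 0\<close> in auto)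
  define C where "C = (\<Sum>\<^sub>\<infinity>x\<in>X - Y. norm (?g \<alpha>\<^sub>0 x))"
  \<comment> \<open>The critical shell has weight \<open>exp (- \<alpha> * m\<^sup>2)\<close>, while
    everything beyond it decays like
    \<open>exp (- \<alpha> * (m\<^sup>2 + \<delta>\<^sup>2))\<close>. Multiplying by the inverse of
    the latter leaves a right-hand side independent of \<alpha>.\<close>
  have main: "norm (v m) * exp (\<alpha> * \<delta>\<^sup>2) \<le> C * exp (\<alpha>\<^sub>0 * (m\<^sup>2 + \<delta>\<^sup>2))" if \<alpha>: "\<alpha> \<ge> \<alpha>\<^sub>0" for \<alpha>
  proof -
    have "(\<Sum>x\<in>Y. ?g \<alpha> x) = (\<Sum>x | x \<in> X \<and> norm (x - z) < m. ?g \<alpha> x) + (\<Sum>x\<in>shell X z m. ?g \<alpha> x)"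
    proof -
      have Y': "Y = {x \<in> X. norm (x - z) < m} \<union> shell X z m" by (auto simp: Y_def shell_def)
      with Y(1) show ?thesis
        unfolding Y' by (intro sum.union_disjoint) (auto simp: shell_def)
    qed
    also have "(\<Sum>x | x \<in> X \<and> norm (x - z) < m. ?g \<alpha> x) = 0"
      using below finite_subset[OF _ Y(1)]
      by (intro sum_radial_eq_0[where w = "\<lambda>s. exp (- \<alpha> * s\<^sup>2)"]) (auto simp: v_def Y_def subset_eq)
    also have "(\<Sum>x\<in>shell X z m. ?g \<alpha> x) = exp (- \<alpha> * m\<^sup>2) *\<^sub>R v m"
      unfolding v_def scaleR_sum_right by (intro sum.cong) (auto simp: shell_def)
    finally have sumY: "(\<Sum>x\<in>Y. ?g \<alpha> x) = exp (- \<alpha> * m\<^sup>2) *\<^sub>R v m" by simp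
    have "infsum (?g \<alpha>) X = infsum (?g \<alpha>) (Y \<union> (X - Y))" using Y by (simp add: Un_absorb1)
    also have "\<dots> = infsum (?g \<alpha>) Y + infsum (?g \<alpha>) (X - Y)"
      by (rule infsum_Un_disjoint[OF summable_on_finite Infinite_Sum.abs_summable_summable[OF abs[OF \<alpha>]]])
        (use Y(1) in auto)
    finally have "exp (- \<alpha> * m\<^sup>2) *\<^sub>R v m = - infsum (?g \<alpha>) (X - Y)"
      using grad[OF \<alpha>] sumY Y(1) by (simp add: eq_neg_iff_add_eq_0)
    from arg_cong[OF this, of norm]
    have "exp (- \<alpha> * m\<^sup>2) * norm (v m) = norm (infsum (?g \<alpha>) (X - Y))"
      by simp
    also have "\<dots> \<le> (\<Sum>\<^sub>\<infinity>x\<in>X - Y. norm (?g \<alpha> x))"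
      by (rule norm_infsum_bound[OF abs[OF \<alpha>]])
    \<comment> \<open>Of the exponent, the share \<open>\<alpha> - \<alpha>\<^sub>0\<close> provides
      uniform decay beyond the gap, and the share \<open>\<alpha>\<^sub>0\<close> keeps the fixed
      convergent series \<open>C\<close>.\<close>
    also have "\<dots> \<le> (\<Sum>\<^sub>\<infinity>x\<in>X - Y. exp (- (\<alpha> - \<alpha>\<^sub>0) * (m\<^sup>2 + \<delta>\<^sup>2)) * norm (?g \<alpha>\<^sub>0 x))"
    proof (rule infsum_mono[OF abs[OF \<alpha>] summable_on_cmult_right[OF abs]])
      fix x assume x: "x \<in> X - Y"
      then have "norm (x - z) \<ge> m + \<delta>" using \<delta> by (auto simp: Y_def not_le)
      then have "(m + \<delta>)\<^sup>2 \<le> (norm (x - z))\<^sup>2" using m0 \<delta> by (intro power_mono) auto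
      moreover have "m\<^sup>2 + \<delta>\<^sup>2 \<le> (m + \<delta>)\<^sup>2" using m0 \<delta> by (simp add: power2_sum)
      ultimately have "(\<alpha> - \<alpha>\<^sub>0) * (m\<^sup>2 + \<delta>\<^sup>2) \<le> (\<alpha> - \<alpha>\<^sub>0) * (norm (x - z))\<^sup>2"
        using \<alpha> by (intro mult_left_mono) auto
      then have "exp (- \<alpha> * (norm (x - z))\<^sup>2)
          \<le> exp (- (\<alpha> - \<alpha>\<^sub>0) * (m\<^sup>2 + \<delta>\<^sup>2)) * exp (- \<alpha>\<^sub>0 * (norm (x - z))\<^sup>2)"
        unfolding exp_add[symmetric] by (simp add: algebra_simps)
      from mult_right_mono[OF this, of "norm (x - z)"]
      show "norm (?g \<alpha> x) \<le> exp (- (\<alpha> - \<alpha>\<^sub>0) * (m\<^sup>2 + \<delta>\<^sup>2)) * norm (?g \<alpha>\<^sub>0 x)"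
        by (simp add: mult.assoc)
    qed simp
    also have "\<dots> = exp (- (\<alpha> - \<alpha>\<^sub>0) * (m\<^sup>2 + \<delta>\<^sup>2)) * C"
      unfolding C_def by (rule infsum_cmult_right')
    finally have "exp (\<alpha> * (m\<^sup>2 + \<delta>\<^sup>2)) * (exp (- \<alpha> * m\<^sup>2) * norm (v m))
        \<le> exp (\<alpha> * (m\<^sup>2 + \<delta>\<^sup>2)) * (exp (- (\<alpha> - \<alpha>\<^sub>0) * (m\<^sup>2 + \<delta>\<^sup>2)) * C)"
      by (rule mult_left_mono) simp
    moreover have "exp (\<alpha> * (m\<^sup>2 + \<delta>\<^sup>2)) * exp (- \<alpha> * m\<^sup>2) = exp (\<alpha> * \<delta>\<^sup>2)"
      "exp (\<alpha> * (m\<^sup>2 + \<delta>\<^sup>2)) * exp (- (\<alpha> - \<alpha>\<^sub>0) * (m\<^sup>2 + \<delta>\<^sup>2)) = exp (\<alpha>\<^sub>0 * (m\<^sup>2 + \<delta>\<^sup>2))"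
      unfolding exp_add[symmetric] by (simp_all add: algebra_simps)
    ultimately have "exp (\<alpha> * \<delta>\<^sup>2) * norm (v m) \<le> exp (\<alpha>\<^sub>0 * (m\<^sup>2 + \<delta>\<^sup>2)) * C"
      by (simp only: mult.assoc[symmetric])
    then show ?thesis by (simp only: mult.commute)
  qed
  define D where "D = C * exp (\<alpha>\<^sub>0 * (m\<^sup>2 + \<delta>\<^sup>2))"
  define a where "a = norm (v m) * \<delta>\<^sup>2"
  have a: "a > 0" using vm \<delta> by (simp add: a_def)
  \<comment> \<open>Chosen so that the bound \<open>exp t \<ge> t\<close> already pushes the left
    side of \<open>main\<close> past \<open>D\<close>; the maximum keeps \<alpha> in the range of
    \<open>main\<close>.\<close>
  define \<alpha> where "\<alpha> = max \<alpha>\<^sub>0 ((D + 1) / a)"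
  have "(D + 1) / a \<le> \<alpha>" by (simp add: \<alpha>_def)
  then have "D + 1 \<le> \<alpha> * a" using a by (simp add: field_simps)
  also have "\<dots> = norm (v m) * (\<alpha> * \<delta>\<^sup>2)" by (simp add: a_def)
  also have "\<dots> \<le> norm (v m) * exp (\<alpha> * \<delta>\<^sup>2)"
    using exp_ge_add_one_self[of "\<alpha> * \<delta>\<^sup>2"] by (intro mult_left_mono norm_ge_zero) linarith
  also have "\<dots> \<le> D" unfolding D_def by (rule main) (simp add: \<alpha>_def)
  finally show False by simp
qed

theorem theorem1p1:
  fixes L :: "(real^'n::finite) set" and z :: "real^'n"
  assumes "full_lattice L"
  shows "((\<forall>r\<ge>0. shell L z r \<noteq> {} \<longrightarrow> spherical_design 1 z r (shell L z r))
           \<longleftrightarrow> (\<forall>\<alpha>>0. critical_point (\<lambda>w. potential (f_exp \<alpha>) L w) z))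
       \<and> ((\<forall>\<alpha>>0. critical_point (\<lambda>w. potential (f_exp \<alpha>) L w) z)
           \<longleftrightarrow> (\<exists>\<alpha>\<^sub>0>0. \<forall>\<alpha>\<ge>\<alpha>\<^sub>0. critical_point (\<lambda>w. potential (f_exp \<alpha>) L w) z))"
proof -
  have L: "uniform_discrete L"
    using assms by (intro uniform_discrete_subgroup) (auto simp: full_lattice_def)
  \<comment> \<open>Shells of negative radius are empty and empty sums are 0, so (1) becomes a
    statement \<open>?S\<close> about all real radii, the hub of the cycle of implications
    below.\<close>
  have designs: "(\<forall>r\<ge>0. shell L z r \<noteq> {} \<longrightarrow> spherical_design 1 z r (shell L z r))
      \<longleftrightarrow> (\<forall>r. (\<Sum>x\<in>shell L z r. x - z) = 0)" (is "?D \<longleftrightarrow> ?S")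
  proof
    assume D: ?D
    show ?S
    proof
      fix r
      have "r \<ge> 0" if "shell L z r \<noteq> {}" using that by (auto simp: shell_def)
      then show "(\<Sum>x\<in>shell L z r. x - z) = 0"
        \<comment> \<open>Simplification rewrites the degree 1 to \<open>Suc 0\<close>, so the
          characterisation is supplied in that form.\<close>
        using D by (cases "shell L z r = {}") (auto simp: spherical_design_1_iff[unfolded One_nat_def])
    qed
  next
    assume ?S
    then show ?D
      unfolding spherical_design_1_iff using finite_shell[OF L] by (auto simp: shell_def)
  qed
  have 12: "\<forall>\<alpha>>0. critical_point (\<lambda>w. potential (f_exp \<alpha>) L w) z" if S: ?S
  proof (intro allI impI)
    fix \<alpha> :: real assume \<alpha>: "\<alpha> > 0"
    have "((\<lambda>x. exp (- \<alpha> * (norm (x - z))\<^sup>2) *\<^sub>R (x - z)) has_sum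
        (\<Sum>\<^sub>\<infinity>x\<in>L. exp (- \<alpha> * (norm (x - z))\<^sup>2) *\<^sub>R (x - z))) L"
      by (intro has_sum_infsum)
      (rule Infinite_Sum.abs_summable_summable[OF abs_summable_on_gaussian_gradient[OF L \<alpha>]])
    then have "(\<Sum>\<^sub>\<infinity>x\<in>L. exp (- \<alpha> * (norm (x - z))\<^sup>2) *\<^sub>R (x - z)) = 0"
      by (rule has_sum_radial_eq_0[OF L S[rule_format], where w = "\<lambda>s. exp (- \<alpha> * s\<^sup>2)"])
    then show "critical_point (\<lambda>w. potential (f_exp \<alpha>) L w) z"
      by (simp only: critical_point_potential_iff[OF L \<alpha>])
  qed
  have 31: ?S if ev: "\<exists>\<alpha>\<^sub>0>0. \<forall>\<alpha>\<ge>\<alpha>\<^sub>0. critical_point (\<lambda>w. potential (f_exp \<alpha>) L w) z"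
  proof -
    obtain \<alpha>\<^sub>0 where \<alpha>\<^sub>0: "\<alpha>\<^sub>0 > 0" "\<And>\<alpha>. \<alpha> \<ge> \<alpha>\<^sub>0 \<Longrightarrow> critical_point (\<lambda>w. potential (f_exp \<alpha>) L w) z"
      using ev by blast
    have "(\<Sum>\<^sub>\<infinity>x\<in>L. exp (- \<alpha> * (norm (x - z))\<^sup>2) *\<^sub>R (x - z)) = 0" if "\<alpha> \<ge> \<alpha>\<^sub>0" for \<alpha>
      using \<alpha>\<^sub>0 that critical_point_potential_iff[OF L, of \<alpha>] by auto
    then show ?S using shell_sum_eq_0[OF L \<alpha>\<^sub>0(1)] by blast
  qed
  have 23: "\<exists>\<alpha>\<^sub>0>0. \<forall>\<alpha>\<ge>\<alpha>\<^sub>0. critical_point (\<lambda>w. potential (f_exp \<alpha>) L w) z"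
    if "\<forall>\<alpha>>0. critical_point (\<lambda>w. potential (f_exp \<alpha>) L w) z"
    using that by (intro exI[of _ 1]) auto
  show ?thesis unfolding designs using 12 23 31 by blast
qed

end
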